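(* Let $n$ be a positive integer. For every $\sigma$-compact set $E\subset\mathbb{R}^n$ we have $$\underline{\dim}_P E\le\dim_U E\le\dim_P E.$$
   Context: $|E|$ denotes the diameter of a set $E$. $\mathcal{D}$ is the family of all sets $D\subset(0,\infty)$ with $\inf D=0$ that are open in the Sorgenfrey topology (generated by the intervals $[a,b)$), i.e. for every $t\in D$ there is $\delta>0$ with $[t,t+\delta)\subset D$. For $D\in\mathcal{D}$, $E\subset\mathbb{R}^n$ and $s\ge0$ let $$\mathcal{H}^s_{D,\infty}(E)=\inf\left\{\sum_{i=1}^\infty|E_i|^s: E\subset\bigcup_{i=1}^\infty E_i,\ |E_i|\in D\text{ for all }i\right\},\qquad \dim_H^D E=\inf\{s\ge0:\mathcal{H}^s_{D,\infty}(E)=0\}.$$ The universal restricted Hausdorff dimension is $\dim_U E=\sup\{\dim_H^D E: D\in\mathcal{D}\}$. With $\overline{\dim}_B$ and $\underline{\dim}_B$ the upper and lower box dimensions of bounded sets, the packing and lower packing dimensions of $X\subset\mathbb{R}^n$ are $$\dim_P X=\inf\left\{\sup_i\overline{\dim}_B X_i: X=\bigcup_{i=1}^\infty X_i,\ X_i\text{ bounded}\right\},\qquad \underline{\dim}_P X=\inf\left\{\sup_i\underline{\dim}_B X_i: X=\bigcup_{i=1}^\infty X_i,\ X_i\text{ bounded}\right\}.$$ *)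

theory Defs
  imports "HOL-Analysis.Analysis"
begin

definition sigma_compact :: "'a::topological_space set \<Rightarrow> bool" where
  "sigma_compact E \<longleftrightarrow> (\<exists>K :: nat \<Rightarrow> 'a set. (\<forall>i. compact (K i)) \<and> E = (\<Union>i. K i))"

(* Nonemptiness of D is part of "inf D = 0" (the infimum of the empty set is infinity), but
   Inf {} is an unspecified real in HOL. *)
definition admissible_diams :: "real set set" where
  "admissible_diams =
    {D. D \<subseteq> {0<..} \<and> D \<noteq> {} \<and> Inf D = 0 \<and> (\<forall>t\<in>D. \<exists>\<delta>>0. {t..<t+\<delta>} \<subseteq> D)}"

(* The covering sets are required to be bounded because the library's diameter is a real number
   and is meaningless on unbounded sets, whose diameter (infinity) is not in D.
   All diameters are positive, so powr gives the value 1 for s = 0. *)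
definition restricted_content :: "real set \<Rightarrow> real \<Rightarrow> 'a::metric_space set \<Rightarrow> ennreal" where
  "restricted_content D s E =
    Inf {(\<Sum>i. ennreal (diameter (A i) powr s)) | A :: nat \<Rightarrow> 'a set.
           E \<subseteq> (\<Union>i. A i) \<and> (\<forall>i. bounded (A i) \<and> diameter (A i) \<in> D)}"

definition restricted_hausdorff_dim :: "real set \<Rightarrow> 'a::metric_space set \<Rightarrow> ereal" where
  "restricted_hausdorff_dim D E = Inf {ereal s | s. 0 \<le> s \<and> restricted_content D s E = 0}"

definition universal_hausdorff_dim :: "'a::metric_space set \<Rightarrow> ereal" where
  "universal_hausdorff_dim E = (SUP D\<in>admissible_diams. restricted_hausdorff_dim D E)"

definition covering_number :: "'a::metric_space set \<Rightarrow> real \<Rightarrow> nat" where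
  "covering_number X r =
    Inf {card F | F. finite F \<and> X \<subseteq> \<Union>F \<and> (\<forall>U\<in>F. bounded U \<and> diameter U \<le> r)}"

(* Both box dimensions are only used for bounded (in R^n: totally bounded) sets.
   Since ln 0 = 0 in HOL, the empty set has box dimension 0. *)
definition upper_box_dim :: "'a::metric_space set \<Rightarrow> ereal" where
  "upper_box_dim X = Limsup (at_right 0) (\<lambda>r. ereal (ln (real (covering_number X r)) / - ln r))"

definition lower_box_dim :: "'a::metric_space set \<Rightarrow> ereal" where
  "lower_box_dim X = Liminf (at_right 0) (\<lambda>r. ereal (ln (real (covering_number X r)) / - ln r))"

definition packing_dim :: "'a::metric_space set \<Rightarrow> ereal" where
  "packing_dim X =
    Inf {(SUP i. upper_box_dim (Y i)) | Y :: nat \<Rightarrow> 'a set. X = (\<Union>i. Y i) \<and> (\<forall>i. bounded (Y i))}"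

definition lower_packing_dim :: "'a::metric_space set \<Rightarrow> ereal" where
  "lower_packing_dim X =
    Inf {(SUP i. lower_box_dim (Y i)) | Y :: nat \<Rightarrow> 'a set. X = (\<Union>i. Y i) \<and> (\<forall>i. bounded (Y i))}"

end

theory Submission
  imports Defs
begin

text \<open>
  The upper bound rests on the fact that every \<open>D\<close> contains arbitrarily small numbers. If a bounded set \<open>Y\<close> has
  upper box dimension below \<open>t\<close>, then for every small \<open>d \<in> D\<close> it is covered by at most
  \<open>(d/2) powr (- t)\<close> sets of diameter at most \<open>d/2\<close>. Each of them lies in a closed ball of radius
  \<open>d/2\<close>, whose diameter is exactly \<open>d\<close>, so that the cover is admissible and costs at most a constant
  times \<open>d powr (s - t)\<close>, which tends to 0 if \<open>t < s\<close>
  (\<open>restricted_content_eq_0_if_upper_box_dim_less\<close>). Nullity of the content is countably stable, and this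
  passes to a decomposition that nearly attains the packing dimension.

  For the lower bound, let \<open>s < s'\<close> lie below the lower packing dimension of \<open>E\<close>. One of the compact pieces
  of \<open>E\<close> is not a countable union of bounded sets of lower box dimension at most \<open>s'\<close>. Removing
  all open portions that are such unions leaves a nonempty compact kernel \<open>K\<close> in which every portion has
  lower box dimension greater than \<open>s'\<close> (\<open>compact_kernel_not_sigma_lower_box_dim_le\<close>).
  A lower box dimension controls all small scales \<open>r\<close>, and compactness makes this control uniform:
  every ball of a given radius centred in \<open>K\<close> contains at least \<open>r powr (- s)\<close> points of \<open>K\<close> whose mutual
  distances are at least \<open>6 * r\<close>, for all \<open>r\<close> below a bound that depends on the radius of the ball only.

  Hence there is a rapidly decreasing sequence of scales \<open>d k\<close> such that each ball of radius \<open>d k\<close> centred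
  in \<open>K\<close> contains that many points separated at scale \<open>d (Suc k)\<close>. The family of diameters is
  \<open>D = (\<Union>k. {d (Suc k)..<2 * d (Suc k)})\<close>. Consider countably many sets with diameters in \<open>D\<close> whose
  \<open>t\<close>-th powers have sum less than 1, where \<open>0 \<le> t \<le> s\<close>. At each scale \<open>d (Suc k)\<close> there are fewer sets of that
  scale than separated points, and a set can come close to one of these points only; so a point can be
  chosen that stays away from all sets of that scale
  (\<open>separated_point_avoiding_one_scale\<close>). Choosing such points successively, each near the
  preceding one, gives a sequence whose limit lies in \<open>K\<close> and in none of the sets. Therefore the sets do not cover \<open>K\<close>, and
  the content of \<open>K\<close> is at least 1 (\<open>restricted_content_ge_1_if_portions_large\<close>).
\<close>

section \<open>Covering numbers and box dimensions\<close>

text \<open>Bounded sets in a Euclidean space are totally bounded, so the infimum that defines the covering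
  number is over a nonempty set of natural numbers and is attained.\<close>

lemma covering_number_witness:
  fixes X :: "'a::euclidean_space set"
  assumes "bounded X" "r > 0"
  obtains F where "finite F" "X \<subseteq> \<Union>F" "\<And>U. U \<in> F \<Longrightarrow> bounded U \<and> diameter U \<le> r"
    "card F = covering_number X r"
proof -
  let ?S = "{card F | F. finite F \<and> X \<subseteq> \<Union>F \<and> (\<forall>U\<in>F. bounded U \<and> diameter U \<le> r)}"
  obtain k where k: "finite k" "closure X \<subseteq> (\<Union>x\<in>k. ball x (r/2))"
    using assms compact_closure[of X] half_gt_zero[of r]
    unfolding compact_eq_totally_bounded by metis
  have "diameter (ball x (r/2)) \<le> r" for x :: 'a
    using assms by (simp add: diameter_ball)
  then have "card ((\<lambda>x. ball x (r/2)) ` k) \<in> ?S"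
    using k closure_subset[of X] by (intro CollectI exI[of _ "(\<lambda>x. ball x (r/2)) ` k"]) auto
  then have "Inf ?S \<in> ?S"
    by (intro Inf_nat_def1) auto
  then show ?thesis
    using that unfolding covering_number_def by force
qed

lemma covering_number_le:
  assumes "finite F" "X \<subseteq> \<Union>F" "\<And>U. U \<in> F \<Longrightarrow> bounded U \<and> diameter U \<le> r"
  shows "covering_number X r \<le> card F"
  unfolding covering_number_def using assms by (intro cInf_lower) auto

lemma covering_number_mono:
  fixes X Y :: "'a::euclidean_space set"
  assumes "X \<subseteq> Y" "bounded Y" "r > 0"
  shows "covering_number X r \<le> covering_number Y r"
proof -
  obtain F where F: "finite F" "Y \<subseteq> \<Union>F" "\<And>U. U \<in> F \<Longrightarrow> bounded U \<and> diameter U \<le> r"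
    "card F = covering_number Y r"
    using covering_number_witness assms by metis
  then show ?thesis
    using covering_number_le[of F X r] assms(1) by auto
qed

lemma ln_of_nat_nonneg: "ln (real n) \<ge> 0"
  by (cases "n = 0") auto

lemma eventually_at_right_0_small:
  "c > 0 \<Longrightarrow> eventually (\<lambda>r::real. 0 < r \<and> r < c) (at_right 0)"
  by (auto simp: eventually_at_right_field)

lemma eventually_at_right_0_scale:
  assumes "eventually P (at_right (0::real))" "c > 0"
  shows "eventually (\<lambda>r. P (c * r)) (at_right 0)"
proof -
  obtain b where "b > 0" "\<And>y. 0 < y \<Longrightarrow> y < b \<Longrightarrow> P y"
    using assms(1) by (auto simp: eventually_at_right_field)
  then show ?thesis
    unfolding eventually_at_right_field using assms(2)
    by (intro exI[of _ "b / c"]) (auto simp: field_simps)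
qed

lemma lower_box_dim_mono:
  fixes X Y :: "'a::euclidean_space set"
  assumes "X \<subseteq> Y" "bounded Y"
  shows "lower_box_dim X \<le> lower_box_dim Y"
  unfolding lower_box_dim_def
proof (rule Liminf_mono, rule eventually_mono[OF eventually_at_right_0_small[of 1]])
  fix r :: real assume r: "0 < r \<and> r < 1"
  have "covering_number X r \<le> covering_number Y r"
    using covering_number_mono assms r by blast
  then have "ln (real (covering_number X r)) \<le> ln (real (covering_number Y r))"
    using ln_of_nat_nonneg by (cases "covering_number X r = 0") auto
  then show "ereal (ln (real (covering_number X r)) / - ln r)
      \<le> ereal (ln (real (covering_number Y r)) / - ln r)"
    using r by (auto intro!: divide_right_mono_neg simp: divide_le_cancel)
qed simp

lemma box_dim_quotient_nonneg:
  "0 < r \<Longrightarrow> r < 1 \<Longrightarrow> 0 \<le> ln (real n) / - ln r"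
  using ln_of_nat_nonneg[of n] by (intro divide_nonneg_nonneg) auto

lemma upper_box_dim_nonneg: "0 \<le> upper_box_dim X"
  unfolding upper_box_dim_def
  by (rule le_Limsup, simp, rule eventually_mono[OF eventually_at_right_0_small[of 1]])
     (auto simp: box_dim_quotient_nonneg simp del: divide_minus_right)

lemma lower_box_dim_empty: "lower_box_dim ({} :: 'a::metric_space set) = 0"
proof -
  have "covering_number ({} :: 'a set) r = 0" for r
    using covering_number_le[of "{}" "{} :: 'a set" r] by simp
  then show ?thesis
    by (simp add: lower_box_dim_def Liminf_const zero_ereal_def)
qed

lemma eventually_covering_number_le:
  assumes "upper_box_dim X < ereal t"
  shows "eventually (\<lambda>r. real (covering_number X r) \<le> r powr (- t)) (at_right 0)"
proof -
  have "eventually (\<lambda>r. ereal (ln (real (covering_number X r)) / - ln r) < ereal t) (at_right 0)"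
    using Limsup_lessD assms unfolding upper_box_dim_def by blast
  then show ?thesis
    using eventually_at_right_0_small[OF zero_less_one]
  proof eventually_elim
    case (elim r)
    then have "ln (real (covering_number X r)) < t * - ln r"
      by (simp add: pos_divide_less_eq del: divide_minus_right)
    then have "ln (real (covering_number X r)) < ln (r powr (- t))"
      using elim by (simp add: ln_powr)
    then show ?case
      using elim ln_less_cancel_iff[of "real (covering_number X r)" "r powr (- t)"]
      by (cases "covering_number X r = 0") (auto simp del: ln_less_cancel_iff)
  qed
qed

text \<open>For \<open>t \<ge> 0\<close> the quotient exceeds a nonnegative number, which excludes covering number 0, where
  \<open>ln 0 = 0\<close> would make the quotient vanish.\<close>

lemma eventually_covering_number_ge:
  assumes "ereal t < lower_box_dim X" "t \<ge> 0"
  shows "eventually (\<lambda>r. r powr (- t) \<le> real (covering_number X r)) (at_right 0)"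
proof -
  have "eventually (\<lambda>r. ereal t < ereal (ln (real (covering_number X r)) / - ln r)) (at_right 0)"
    using less_LiminfD assms(1) unfolding lower_box_dim_def by blast
  then show ?thesis
    using eventually_at_right_0_small[OF zero_less_one]
  proof eventually_elim
    case (elim r)
    then have *: "ln (real (covering_number X r)) > t * - ln r"
      by (simp add: pos_less_divide_eq del: divide_minus_right)
    have "t * - ln r \<ge> 0"
      using assms(2) elim by (intro mult_nonneg_nonneg) auto
    then have "covering_number X r \<noteq> 0"
      using * by (intro notI) simp
    moreover have "ln (real (covering_number X r)) > ln (r powr (- t))"
      using elim * by (simp add: ln_powr)
    ultimately show ?case
      using elim(2) ln_less_cancel_iff[of "r powr (- t)" "real (covering_number X r)"] by linarith
  qed
qed

section \<open>Restricted contents and the upper bound\<close>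

lemma admissible_diams_pos: "D \<in> admissible_diams \<Longrightarrow> d \<in> D \<Longrightarrow> d > 0"
  unfolding admissible_diams_def by auto

lemma admissible_diams_arbitrarily_small:
  assumes "D \<in> admissible_diams" "eventually P (at_right 0)"
  obtains d where "d \<in> D" "P d"
proof -
  obtain b where b: "b > 0" "\<And>y. 0 < y \<Longrightarrow> y < b \<Longrightarrow> P y"
    using assms(2) by (auto simp: eventually_at_right_field)
  have "D \<noteq> {}" "Inf D = 0" 
    using assms(1) by (auto simp: admissible_diams_def)
  then obtain d where "d \<in> D" "d < b"
    using b(1) cInf_lessD by metis
  then show ?thesis
    using that b(2) admissible_diams_pos[OF assms(1)] by blast
qed

lemma restricted_content_eq_0I:
  assumes "\<And>e. e > 0 \<Longrightarrow> \<exists>A. E \<subseteq> (\<Union>i. A i) \<and> (\<forall>i. bounded (A i) \<and> diameter (A i) \<in> D) \<and>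
    (\<Sum>i. ennreal (diameter (A i) powr s)) \<le> ennreal e"
  shows "restricted_content D s E = 0"
proof -
  have "restricted_content D s E \<le> 0 + ennreal e" if "e > 0" for e
    using assms[OF that] unfolding restricted_content_def
    by (smt (verit, ccfv_threshold) Inf_lower2 add_0 mem_Collect_eq)
  then show ?thesis
    using ennreal_le_epsilon[of 0 "restricted_content D s E"] by fastforce
qed

lemma restricted_content_lessD:
  assumes "restricted_content D s E < c"
  shows "\<exists>A. E \<subseteq> (\<Union>i. A i) \<and> (\<forall>i. bounded (A i) \<and> diameter (A i) \<in> D) \<and>
    (\<Sum>i. ennreal (diameter (A i) powr s)) < c"
  using assms unfolding restricted_content_def Inf_less_iff by auto

lemma restricted_content_mono:
  "E \<subseteq> F \<Longrightarrow> restricted_content D s E \<le> restricted_content D s F"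
  unfolding restricted_content_def by (intro Inf_superset_mono) auto

lemma suminf_ennreal_geometric:
  "e \<ge> 0 \<Longrightarrow> (\<Sum>i. ennreal (e * (1/2) ^ Suc i)) = ennreal e"
proof -
  assume e: "e \<ge> 0"
  have "(\<lambda>i. e * (1/2) ^ Suc i) sums (e * 1)"
    by (intro sums_mult power_half_series)
  then show ?thesis
    using e by (intro suminf_ennreal_eq) auto
qed

text \<open>Covers of the pieces with geometrically decreasing costs are merged into one sequence by the
  pairing function.\<close>

lemma restricted_content_Union_eq_0:
  fixes Y :: "nat \<Rightarrow> 'a::metric_space set"
  assumes "\<And>i. restricted_content D s (Y i) = 0"
  shows "restricted_content D s (\<Union>i. Y i) = 0"
proof (rule restricted_content_eq_0I)
  fix e :: real assume e: "e > 0"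
  have "\<exists>A. Y i \<subseteq> (\<Union>j. A j) \<and> (\<forall>j. bounded (A j) \<and> diameter (A j) \<in> D) \<and>
      (\<Sum>j. ennreal (diameter (A j) powr s)) < ennreal (e * (1/2) ^ Suc i)" for i
  proof -
    have "restricted_content D s (Y i) < ennreal (e * (1/2) ^ Suc i)"
      using e assms by (simp add: ennreal_zero_less_mult_iff)
    then show ?thesis
      by (rule restricted_content_lessD)
  qed
  then obtain A where A: "\<And>i. Y i \<subseteq> (\<Union>j. A i j)"
    "\<And>i j. bounded (A i j) \<and> diameter (A i j) \<in> D"
    "\<And>i. (\<Sum>j. ennreal (diameter (A i j) powr s)) < ennreal (e * (1/2) ^ Suc i)"
    by metis
  define B where "B k = (case prod_decode k of (i, j) \<Rightarrow> A i j)" for k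
  have "(\<Sum>k. ennreal (diameter (B k) powr s))
      = (\<Sum>k. (\<lambda>(i, j). ennreal (diameter (A i j) powr s)) (prod_decode k))"
    by (simp add: B_def case_prod_beta)
  also have "\<dots> = (\<Sum>i. \<Sum>j. ennreal (diameter (A i j) powr s))"
    by (rule suminf_ennreal_2dimen) simp
  also have "\<dots> \<le> (\<Sum>i. ennreal (e * (1/2) ^ Suc i))"
    using A(3) by (intro suminf_le) (auto intro: less_imp_le)
  also have "\<dots> = ennreal e"
    using e by (intro suminf_ennreal_geometric) auto
  finally have "(\<Sum>k. ennreal (diameter (B k) powr s)) \<le> ennreal e" .
  moreover have "(\<Union>i. Y i) \<subseteq> (\<Union>k. B k)"
  proof
    fix x assume "x \<in> (\<Union>i. Y i)"
    then obtain i j where "x \<in> A i j"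
      using A(1) by blast
    then have "x \<in> B (prod_encode (i, j))"
      by (simp add: B_def)
    then show "x \<in> (\<Union>k. B k)" by blast
  qed
  moreover have "\<forall>k. bounded (B k) \<and> diameter (B k) \<in> D"
    using A(2) by (simp add: B_def case_prod_beta)
  ultimately show "\<exists>B. (\<Union>i. Y i) \<subseteq> (\<Union>k. B k) \<and> (\<forall>k. bounded (B k) \<and> diameter (B k) \<in> D) \<and>
      (\<Sum>k. ennreal (diameter (B k) powr s)) \<le> ennreal e"
    by blast
qed

lemma powr_mult_tendsto_0_at_right:
  fixes a c :: real
  assumes "a > 0"
  shows "((\<lambda>d. c * d powr a) \<longlongrightarrow> 0) (at_right 0)"
proof -
  have "((\<lambda>d. d powr a) \<longlongrightarrow> 0) (at_right (0::real))"
    using assms by (intro tendsto_zero_powrI) (auto simp: eventually_at_right_field intro: tendsto_ident_at exI[of _ 1])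
  then show ?thesis
    by (rule tendsto_mult_right_zero)
qed

text \<open>A cover at a single scale suffices. The sets of the cover are enlarged to balls because their
  diameters must belong to \<open>D\<close>, not merely be bounded by an element of \<open>D\<close>.\<close>

lemma restricted_content_eq_0_if_upper_box_dim_less:
  fixes Y :: "'a::euclidean_space set"
  assumes D: "D \<in> admissible_diams" and Y: "bounded Y" and s: "upper_box_dim Y < ereal s"
  shows "restricted_content D s Y = 0"
proof (rule restricted_content_eq_0I)
  fix e :: real assume e: "e > 0"
  obtain t where t: "upper_box_dim Y < ereal t" "t < s"
    using s ereal_dense2 by (metis ereal_less(1) less_ereal.simps(1))
  have t0: "t > 0"
    using le_less_trans[OF upper_box_dim_nonneg t(1)] by simp
  have "eventually (\<lambda>d. real (covering_number Y (d/2)) \<le> (d/2) powr (- t)) (at_right 0)"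
    using eventually_at_right_0_scale[OF eventually_covering_number_le[OF t(1)], of "1/2"] by simp
  moreover have "eventually (\<lambda>d. 2 powr t * d powr (s - t) < e/2) (at_right 0)"
    using order_tendstoD(2)[OF powr_mult_tendsto_0_at_right, of "s - t" "e/2" "2 powr t"] t e by simp
  ultimately obtain d where d: "d \<in> D" "real (covering_number Y (d/2)) \<le> (d/2) powr (- t)"
      "2 powr t * d powr (s - t) < e/2"
    using admissible_diams_arbitrarily_small[OF D] eventually_conj by (metis (no_types, lifting))
  have d0: "d > 0"
    using admissible_diams_pos D d(1) by blast
  have "\<exists>c\<in>D. c powr s < e/2 * (1/2) ^ Suc i" for i
  proof -
    have "eventually (\<lambda>c. 1 * c powr s < e/2 * (1/2) ^ Suc i) (at_right 0)"
      using order_tendstoD(2)[OF powr_mult_tendsto_0_at_right, of s "e/2 * (1/2) ^ Suc i" 1] e t t0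
      by simp
    then obtain c where "c \<in> D" "1 * c powr s < e/2 * (1/2) ^ Suc i"
      by (rule admissible_diams_arbitrarily_small[OF D])
    then show ?thesis
      by (intro bexI[of _ c]) simp_all
  qed
  then obtain c where c: "\<And>i. c i \<in> D" "\<And>i. c i powr s < e/2 * (1/2) ^ Suc i"
    by metis
  obtain F where F: "finite F" "Y \<subseteq> \<Union>F" "\<And>U. U \<in> F \<Longrightarrow> bounded U \<and> diameter U \<le> d/2"
    "card F = covering_number Y (d/2)"
    using covering_number_witness[OF Y, of "d/2"] d0 by auto
  define N where "N = card F"
  \<comment> \<open>The cover of \<open>Y\<close> is finite; the sequence of sets is continued by balls so small that their
    total cost is at most \<open>e/2\<close>. Diameters in \<open>D\<close> are positive, hence empty sets cannot be used.\<close>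
  obtain f where f: "bij_betw f {..<N} F"
    using F(1) ex_bij_betw_nat_finite unfolding N_def lessThan_atLeast0 by blast
  define x where "x U = (SOME z. z \<in> U)" for U :: "'a set"
  define A where "A i = (if i < N then cball (x (f i)) (d/2) else cball 0 (c i / 2))" for i
  have dA: "diameter (A i) = (if i < N then d else c i)" for i
    using d0 admissible_diams_pos[OF D c(1), of i] by (simp add: A_def diameter_cball)
  have "Y \<subseteq> (\<Union>i. A i)"
  proof
    fix y assume "y \<in> Y"
    then obtain i where i: "i < N" "y \<in> f i"
      using F(2) f unfolding bij_betw_def by blast
    then have "f i \<in> F" "x (f i) \<in> f i"
      using f someI[of "\<lambda>z. z \<in> f i"] by (auto simp: x_def bij_betw_def)
    then have "dist (x (f i)) y \<le> d/2"
      using F(3) i(2) diameter_bounded_bound by (metis order_trans)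
    then show "y \<in> (\<Union>i. A i)"
      using i(1) by (intro UN_I[of i]) (auto simp: A_def)
  qed
  moreover have "\<forall>i. bounded (A i) \<and> diameter (A i) \<in> D"
    using d(1) c(1) by (auto simp: dA) (auto simp: A_def)
  moreover have "(\<Sum>i. ennreal (diameter (A i) powr s)) \<le> ennreal e"
  proof -
    have "(\<Sum>i. ennreal (diameter (A i) powr s))
        \<le> (\<Sum>i. ennreal (if i < N then d powr s else 0) + ennreal (e/2 * (1/2) ^ Suc i))"
    proof (rule suminf_le)
      fix i
      show "ennreal (diameter (A i) powr s)
          \<le> ennreal (if i < N then d powr s else 0) + ennreal (e/2 * (1/2) ^ Suc i)"
        using c(2)[of i] by (cases "i < N") (auto simp: dA intro!: ennreal_leI)
    qed auto
    also have "\<dots> = (\<Sum>i. ennreal (if i < N then d powr s else 0)) + (\<Sum>i. ennreal (e/2 * (1/2) ^ Suc i))"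
      by (rule suminf_add[symmetric]) auto
    also have "(\<Sum>i. ennreal (e/2 * (1/2) ^ Suc i)) = ennreal (e/2)"
      using e by (intro suminf_ennreal_geometric) simp
    also have "(\<Sum>i. ennreal (if i < N then d powr s else 0)) = (\<Sum>i<N. ennreal (d powr s))"
      by (subst suminf_finite[of "{..<N}"]) auto
    also have "\<dots> = ennreal (real N * d powr s)"
      by (simp add: ennreal_mult ennreal_of_nat_eq_real_of_nat)
    also have "ennreal (real N * d powr s) + ennreal (e/2) = ennreal (real N * d powr s + e/2)"
      using e by (intro ennreal_plus[symmetric]) auto
    also have "\<dots> \<le> ennreal e"
    proof (rule ennreal_leI)
      have "real N * d powr s \<le> (d/2) powr (- t) * d powr s"
        using d(2) F(4) by (intro mult_right_mono) (auto simp: N_def)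
      also have "\<dots> = 2 powr t * d powr (s - t)"
        using d0 by (simp add: powr_divide powr_minus powr_diff field_simps)
      finally show "real N * d powr s + e/2 \<le> e"
        using d(3) by simp
    qed
    finally show ?thesis .
  qed
  ultimately show "\<exists>A. Y \<subseteq> (\<Union>i. A i) \<and> (\<forall>i. bounded (A i) \<and> diameter (A i) \<in> D) \<and>
      (\<Sum>i. ennreal (diameter (A i) powr s)) \<le> ennreal e"
    by blast
qed

lemma universal_hausdorff_dim_le_packing_dim:
  fixes E :: "'a::euclidean_space set"
  shows "universal_hausdorff_dim E \<le> packing_dim E"
  unfolding universal_hausdorff_dim_def packing_dim_def
proof (intro SUP_least Inf_greatest, clarify)
  fix D and Y :: "nat \<Rightarrow> 'a set"
  assume D: "D \<in> admissible_diams" and Y: "\<forall>i. bounded (Y i)"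
  show "restricted_hausdorff_dim D (\<Union>i. Y i) \<le> (SUP i. upper_box_dim (Y i))"
  proof (rule ereal_le_real)
    fix s assume "(SUP i. upper_box_dim (Y i)) \<le> ereal s"
    then have s: "upper_box_dim (Y i) \<le> ereal s" for i
      by (meson SUP_upper UNIV_I order_trans)
    have s0: "0 \<le> s"
      using order_trans[OF upper_box_dim_nonneg s] by simp
    have "restricted_hausdorff_dim D (\<Union>i. Y i) \<le> ereal s + ereal \<epsilon>" if "\<epsilon> > 0" for \<epsilon>
    proof -
      have "upper_box_dim (Y i) < ereal (s + \<epsilon>)" for i
        using that by (intro le_less_trans[OF s]) simp
      then have "restricted_content D (s + \<epsilon>) (\<Union>i. Y i) = 0"
        using restricted_content_eq_0_if_upper_box_dim_less D Y restricted_content_Union_eq_0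
        by metis
      then show ?thesis
        using s0 that unfolding restricted_hausdorff_dim_def
        by (intro Inf_lower CollectI exI[of _ "s + \<epsilon>"]) auto
    qed
    then show "restricted_hausdorff_dim D (\<Union>i. Y i) \<le> ereal s"
      by (rule ereal_le_epsilon2)
  qed
qed

section \<open>Portions of large lower box dimension\<close>

text \<open>Inclusion instead of equality makes the property hereditary by definition.\<close>

definition sigma_lower_box_dim_le :: "real \<Rightarrow> 'a::metric_space set \<Rightarrow> bool" where
  "sigma_lower_box_dim_le s X \<longleftrightarrow>
    (\<exists>Y :: nat \<Rightarrow> 'a set. X \<subseteq> (\<Union>i. Y i) \<and> (\<forall>i. bounded (Y i) \<and> lower_box_dim (Y i) \<le> ereal s))"

lemma lower_packing_dim_le_if_sigma_lower_box_dim_le: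
  fixes X :: "'a::euclidean_space set"
  assumes "sigma_lower_box_dim_le s X"
  shows "lower_packing_dim X \<le> ereal s"
proof -
  obtain Y :: "nat \<Rightarrow> 'a set" where Y: "X \<subseteq> (\<Union>i. Y i)" "\<And>i. bounded (Y i)" "\<And>i. lower_box_dim (Y i) \<le> ereal s"
    using assms unfolding sigma_lower_box_dim_le_def by blast
  have "lower_box_dim (X \<inter> Y i) \<le> ereal s" for i
    using lower_box_dim_mono[of "X \<inter> Y i" "Y i"] Y by (meson inf_le2 order_trans)
  moreover have "X = (\<Union>i. X \<inter> Y i)" "\<And>i. bounded (X \<inter> Y i)"
    using Y by auto
  ultimately show ?thesis
    unfolding lower_packing_dim_def
    by (intro Inf_lower2[of "SUP i. lower_box_dim (X \<inter> Y i)"] SUP_least CollectI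
          exI[of _ "\<lambda>i. X \<inter> Y i"]) auto
qed

lemma sigma_lower_box_dim_le_subset:
  "sigma_lower_box_dim_le s X \<Longrightarrow> Z \<subseteq> X \<Longrightarrow> sigma_lower_box_dim_le s Z"
  unfolding sigma_lower_box_dim_le_def by (meson subset_trans)

lemma sigma_lower_box_dim_le_Union:
  fixes \<X> :: "'a::metric_space set set"
  assumes "countable \<X>" "\<And>X. X \<in> \<X> \<Longrightarrow> sigma_lower_box_dim_le s X" "s \<ge> 0"
  shows "sigma_lower_box_dim_le s (\<Union>\<X>)"
proof -
  obtain Y where Y: "\<And>X. X \<in> \<X> \<Longrightarrow> X \<subseteq> (\<Union>i::nat. Y X i) \<and>
      (\<forall>i. bounded (Y X i) \<and> lower_box_dim (Y X i) \<le> ereal s)"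
    using assms(2) unfolding sigma_lower_box_dim_le_def by metis
  \<comment> \<open>The empty set is thrown in so that the family can be enumerated by all natural numbers.\<close>
  define \<Y> where "\<Y> = insert {} ((\<lambda>(X, i). Y X i) ` (\<X> \<times> UNIV))"
  have "countable \<Y>" "\<Y> \<noteq> {}"
    using assms(1) by (auto simp: \<Y>_def)
  then obtain Z :: "nat \<Rightarrow> 'a set" where Z: "range Z = \<Y>"
    by (metis range_from_nat_into)
  have "bounded (Z i) \<and> lower_box_dim (Z i) \<le> ereal s" for i
  proof -
    have "Z i \<in> \<Y>" using Z by blast
    then show ?thesis
      using Y assms(3) by (auto simp: \<Y>_def lower_box_dim_empty)
  qed
  moreover have "\<Union>\<X> \<subseteq> \<Union>\<Y>"
    proof
    fix x assume "x \<in> \<Union>\<X>"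
    then obtain X i where "X \<in> \<X>" "x \<in> Y X i"
      using Y by blast
    then show "x \<in> \<Union>\<Y>"
      unfolding \<Y>_def by blast
  qed
  ultimately show ?thesis
    unfolding sigma_lower_box_dim_le_def using Z by (intro exI[of _ Z]) simp
qed

text \<open>The removed part is a countable union of small portions by the Lindelof property. If a portion of
  the remaining kernel \<open>K\<close> had lower box dimension at most \<open>s\<close>, then adding the removed part would show that the
  corresponding portion of \<open>X\<close> is small as well, so that it would have been removed.\<close>

lemma compact_kernel_not_sigma_lower_box_dim_le:
  fixes X :: "'a::euclidean_space set"
  assumes X: "compact X" "\<not> sigma_lower_box_dim_le s X" and s: "s \<ge> 0"
  obtains K where "compact K" "K \<noteq> {}" "K \<subseteq> X"
    "\<And>x \<rho>. x \<in> K \<Longrightarrow> \<rho> > 0 \<Longrightarrow> ereal s < lower_box_dim (K \<inter> ball x \<rho>)"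
proof -
  define \<V> where "\<V> = {V. open V \<and> sigma_lower_box_dim_le s (X \<inter> V)}"
  obtain \<V>' where \<V>': "\<V>' \<subseteq> \<V>" "countable \<V>'" "\<Union>\<V>' = \<Union>\<V>"
    using Lindelof[of \<V>] unfolding \<V>_def by blast
  have small: "sigma_lower_box_dim_le s (X \<inter> \<Union>\<V>)"
  proof -
    have "sigma_lower_box_dim_le s (\<Union>((\<lambda>V. X \<inter> V) ` \<V>'))"
      using \<V>' s by (intro sigma_lower_box_dim_le_Union) (auto simp: \<V>_def)
    then show ?thesis
      using \<V>'(3) by (metis Int_Union)
  qed
  define K where "K = X - \<Union>\<V>"
  have "compact K"
    unfolding K_def using X(1) by (intro compact_diff open_Union) (auto simp: \<V>_def)
  moreover have "K \<noteq> {}"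
  proof
    assume "K = {}"
    then have "X \<subseteq> X \<inter> \<Union>\<V>" by (auto simp: K_def)
    then show False
      using small X(2) sigma_lower_box_dim_le_subset by blast
  qed
  moreover have "ereal s < lower_box_dim (K \<inter> ball x \<rho>)" if "x \<in> K" "\<rho> > 0" for x \<rho>
  proof (rule ccontr)
    assume "\<not> ereal s < lower_box_dim (K \<inter> ball x \<rho>)"
    then have "sigma_lower_box_dim_le s (K \<inter> ball x \<rho>)"
      unfolding sigma_lower_box_dim_le_def
      by (intro exI[of _ "\<lambda>_. K \<inter> ball x \<rho>"]) (auto simp: not_less)
    then have "sigma_lower_box_dim_le s (\<Union>{K \<inter> ball x \<rho>, X \<inter> \<Union>\<V>})"
      using small s by (intro sigma_lower_box_dim_le_Union) auto
    then have "sigma_lower_box_dim_le s (X \<inter> ball x \<rho>)"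
      by (rule sigma_lower_box_dim_le_subset) (auto simp: K_def)
    then have "ball x \<rho> \<in> \<V>"
      by (simp add: \<V>_def)
    then have "x \<in> \<Union>\<V>" using \<open>\<rho> > 0\<close> by (metis UnionI centre_in_ball)
    then show False
      using that(1) by (simp add: K_def)
  qed
  ultimately show ?thesis
    using that[of K] unfolding K_def by blast
qed

section \<open>Separated points and the restricting family of diameters\<close>

text \<open>If all \<open>r\<close>-separated finite sets had fewer elements than the covering number, one of them would be of maximal
  size, and the balls of radius \<open>r\<close> around its points would cover \<open>X\<close>, which is absurd.\<close>

lemma separated_subset_card_ge_covering_number:
  fixes X :: "'a::metric_space set"
  assumes "r > 0"
  shows "\<exists>P. finite P \<and> P \<subseteq> X \<and> (\<forall>p\<in>P. \<forall>q\<in>P. p \<noteq> q \<longrightarrow> r \<le> dist p q) \<and>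
    covering_number X (2 * r) \<le> card P"
proof -
  define Q where "Q P \<longleftrightarrow> finite P \<and> P \<subseteq> X \<and> (\<forall>p\<in>P. \<forall>q\<in>P. p \<noteq> q \<longrightarrow> r \<le> dist p q)" for P
  have "\<exists>P. Q P \<and> covering_number X (2 * r) \<le> card P"
  proof (rule ccontr)
    assume no: "\<not> ?thesis"
    then have bd: "\<forall>P. Q P \<longrightarrow> card P < covering_number X (2 * r)"
      by (metis not_le)
    have "Q {}" by (simp add: Q_def)
    then obtain P where P: "Q P" "\<And>P'. Q P' \<Longrightarrow> card P' \<le> card P"
      using ex_has_greatest_nat[of Q "{}" card] bd by metis
    have "X \<subseteq> \<Union>((\<lambda>p. cball p r) ` P)"
    proof
      fix y assume "y \<in> X"
      show "y \<in> \<Union>((\<lambda>p. cball p r) ` P)"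
      proof (rule ccontr)
        assume "y \<notin> \<Union>((\<lambda>p. cball p r) ` P)"
        then have far: "\<forall>p\<in>P. r < dist p y"
          by (auto simp: not_le)
        then have "y \<notin> P" using assms by force
        moreover have "Q (insert y P)"
          using P(1) far \<open>y \<in> X\<close> unfolding Q_def by (auto simp: dist_commute less_imp_le)
        ultimately show False
          using P(1) P(2)[of "insert y P"] by (simp add: Q_def)
      qed
    qed
    moreover have "diameter (cball p r) \<le> 2 * r" for p :: 'a
    proof -
      have "dist x y \<le> 2 * r" if "x \<in> cball p r" "y \<in> cball p r" for x y
        using that dist_triangle[of x y p] by (simp add: dist_commute)
      moreover have "cball p r \<noteq> {}"
        using assms by auto
      ultimately show ?thesis
        unfolding diameter_def by (auto intro!: cSUP_least)
    qed
    ultimately have "covering_number X (2 * r) \<le> card ((\<lambda>p. cball p r) ` P)"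
      using P(1) by (intro covering_number_le) (auto simp: Q_def)
    also have "\<dots> \<le> card P"
      using P(1) by (intro card_image_le) (auto simp: Q_def)
    finally show False
      using bd P(1) by fastforce
  qed
  then show ?thesis
    by (simp only: Q_def conj_assoc)
qed


text \<open>For one centre the bound is that of the lower box dimension, and at the scale \<open>12 * r\<close>,
  which yields points separated by \<open>6 * r\<close>; the gap between \<open>s\<close> and \<open>s'\<close> absorbs the factor 12. Finitely many balls of radius \<open>\<rho>/2\<close> cover \<open>K\<close>, and every \<open>ball x \<rho>\<close> with
  centre in \<open>K\<close> contains one of them, which gives a bound \<open>r0\<close> that does not depend on \<open>x\<close>.\<close>

lemma uniformly_many_separated_points:
  fixes K :: "'a::metric_space set"
  assumes K: "compact K"
    and dim: "\<And>x \<rho>. x \<in> K \<Longrightarrow> \<rho> > 0 \<Longrightarrow> ereal s' < lower_box_dim (K \<inter> ball x \<rho>)"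
    and s: "0 \<le> s" "s < s'" and \<rho>: "\<rho> > 0"
  shows "\<exists>r0>0. \<forall>r x. 0 < r \<longrightarrow> r < r0 \<longrightarrow> x \<in> K \<longrightarrow>
      (\<exists>P. finite P \<and> P \<subseteq> K \<inter> ball x \<rho> \<and> (\<forall>p\<in>P. \<forall>q\<in>P. p \<noteq> q \<longrightarrow> 6 * r \<le> dist p q) \<and>
        r powr (- s) \<le> real (card P))"
proof -
  have "\<exists>b>0. \<forall>r. 0 < r \<longrightarrow> r < b \<longrightarrow> r powr (- s) \<le> real (covering_number (K \<inter> ball y (\<rho>/2)) (12 * r))"
    if y: "y \<in> K" for y
  proof -
    have "eventually (\<lambda>u. u powr (- s') \<le> real (covering_number (K \<inter> ball y (\<rho>/2)) u)) (at_right 0)"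
      using dim[OF y, of "\<rho>/2"] \<rho> s by (intro eventually_covering_number_ge) auto
    then have 1: "eventually (\<lambda>r. (12 * r) powr (- s') \<le> real (covering_number (K \<inter> ball y (\<rho>/2)) (12 * r))) (at_right 0)"
      by (rule eventually_at_right_0_scale) simp
    have 2: "eventually (\<lambda>r. 12 powr s' * r powr (s' - s) < 1) (at_right 0)"
      using order_tendstoD(2)[OF powr_mult_tendsto_0_at_right, of "s' - s" 1 "12 powr s'"] s by simp
    have "eventually (\<lambda>r. r powr (- s) \<le> real (covering_number (K \<inter> ball y (\<rho>/2)) (12 * r))) (at_right 0)"
      using 1 2 eventually_at_right_0_small[OF zero_less_one]
    proof eventually_elim
      case (elim r)
      have "r powr (- s) = (12 powr s' * r powr (s' - s)) * (12 * r) powr (- s')"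
        using elim(3) by (simp add: powr_mult powr_diff powr_minus field_simps)
      also have "\<dots> \<le> 1 * (12 * r) powr (- s')"
        using elim(2) by (intro mult_right_mono) auto
      finally show ?case
        using elim(1) by simp
    qed
    then show ?thesis
      unfolding eventually_at_right_field by blast
  qed
  then obtain b where b: "\<And>y. y \<in> K \<Longrightarrow> b y > 0"
    "\<And>y r. y \<in> K \<Longrightarrow> 0 < r \<Longrightarrow> r < b y \<Longrightarrow> r powr (- s) \<le> real (covering_number (K \<inter> ball y (\<rho>/2)) (12 * r))"
    by metis
  obtain T where T: "T \<subseteq> K" "finite T" "K \<subseteq> (\<Union>y\<in>T. ball y (\<rho>/2))"
    using compactE_image[OF K, of K "\<lambda>y. ball y (\<rho>/2)"] \<rho> by force
  define r0 where "r0 = Min (insert 1 (b ` T))"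
  show ?thesis
  proof (intro exI[of _ r0] conjI allI impI)
    show "r0 > 0"
      using T b(1) by (auto simp: r0_def)
    fix r x assume r: "0 < r" "r < r0" and x: "x \<in> K"
    obtain y where y: "y \<in> T" "dist y x < \<rho>/2"
      using T(3) x by auto
    have "r < b y"
      using r(2) y(1) T(2) by (auto simp: r0_def)
    then have N: "r powr (- s) \<le> real (covering_number (K \<inter> ball y (\<rho>/2)) (12 * r))"
      using b(2) y T(1) r(1) by blast
    have "6 * r > 0"
      using r(1) by simp
    from separated_subset_card_ge_covering_number[OF this, of "K \<inter> ball y (\<rho>/2)"]
    obtain P where P: "finite P" "P \<subseteq> K \<inter> ball y (\<rho>/2)"
      "\<forall>p\<in>P. \<forall>q\<in>P. p \<noteq> q \<longrightarrow> 6 * r \<le> dist p q"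
      "covering_number (K \<inter> ball y (\<rho>/2)) (2 * (6 * r)) \<le> card P"
      by (elim exE conjE)
    have "ball y (\<rho>/2) \<subseteq> ball x \<rho>"
    proof
      fix z assume "z \<in> ball y (\<rho>/2)"
      then show "z \<in> ball x \<rho>"
        using y(2) dist_triangle[of x z y] by (simp add: dist_commute)
    qed
    moreover have "r powr (- s) \<le> real (card P)"
      using N P(4) by simp
    ultimately show "\<exists>P. finite P \<and> P \<subseteq> K \<inter> ball x \<rho> \<and> (\<forall>p\<in>P. \<forall>q\<in>P. p \<noteq> q \<longrightarrow> 6 * r \<le> dist p q) \<and>
        r powr (- s) \<le> real (card P)"
      using P(1-3) by (intro exI[of _ P] conjI) auto
  qed
qed

text \<open>A set of diameter less than \<open>2 * d\<close> cannot meet the balls of radius \<open>2 * d\<close> around two points at distance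
  at least \<open>6 * d\<close>. If every point of \<open>P\<close> were approached by a set of scale \<open>d\<close>, these sets would therefore be
  distinct, and each contributes at least \<open>d powr t\<close> to the sum, in total at least
  \<open>d powr (- s) * d powr t\<close>, which is at least 1 because \<open>d \<le> 1\<close> and \<open>t \<le> s\<close>.\<close>

lemma separated_point_avoiding_one_scale:
  fixes P :: "'a::metric_space set"
  assumes P: "finite P" "\<And>p q. p \<in> P \<Longrightarrow> q \<in> P \<Longrightarrow> p \<noteq> q \<Longrightarrow> 6 * d \<le> dist p q"
      "d powr (- s) \<le> real (card P)"
    and d: "0 < d" "d \<le> 1" and t: "0 \<le> t" "t \<le> s"
    and A: "\<And>i. bounded (A i)" "(\<Sum>i. ennreal (diameter (A i) powr t)) < 1"
  shows "\<exists>p\<in>P. \<forall>i. diameter (A i) \<in> {d..<2*d} \<longrightarrow> A i \<inter> cball p (2*d) = {}"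
proof (rule ccontr)
  assume "\<not> ?thesis"
  then have "\<forall>p\<in>P. \<exists>i. diameter (A i) \<in> {d..<2*d} \<and> A i \<inter> cball p (2*d) \<noteq> {}"
    by simp
  then obtain i where i: "\<And>p. p \<in> P \<Longrightarrow> diameter (A (i p)) \<in> {d..<2*d}"
    "\<And>p. p \<in> P \<Longrightarrow> A (i p) \<inter> cball p (2*d) \<noteq> {}"
    unfolding bchoice_iff by blast
  have inj: "inj_on i P"
  proof (rule inj_onI, rule ccontr)
    fix p q assume pq: "p \<in> P" "q \<in> P" "i p = i q" "p \<noteq> q"
    obtain x y where xy: "x \<in> A (i p)" "dist p x \<le> 2*d" "y \<in> A (i p)" "dist q y \<le> 2*d"
      using i(2)[OF pq(1)] i(2)[OF pq(2)] pq(3) by auto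
    have "dist x y < 2*d"
      using diameter_bounded_bound[OF A(1) xy(1,3)] i(1)[OF pq(1)] by simp
    then have "dist p q < 6*d"
      using xy dist_triangle[of p q x] dist_triangle[of x q y] by (simp add: dist_commute)
    then show False
      using P(2) pq by fastforce
  qed
  have "1 = d powr (- t) * d powr t"
    using d by (simp add: powr_minus)
  also have "\<dots> \<le> d powr (- s) * d powr t"
    using d t by (intro mult_right_mono powr_mono') auto
  also have "\<dots> \<le> real (card P) * d powr t"
    using P(3) by (intro mult_right_mono) auto
  also have "\<dots> = (\<Sum>p\<in>P. d powr t)"
    by simp
  also have "\<dots> \<le> (\<Sum>p\<in>P. diameter (A (i p)) powr t)"
    using i(1) d t by (intro sum_mono powr_mono2) auto
  also have "\<dots> = (\<Sum>j\<in>i ` P. diameter (A j) powr t)"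
    by (simp add: sum.reindex[OF inj])
  finally have "1 \<le> ennreal (\<Sum>j\<in>i ` P. diameter (A j) powr t)"
    by (metis ennreal_1 ennreal_leI)
  also have "\<dots> = (\<Sum>j\<in>i ` P. ennreal (diameter (A j) powr t))"
    by (simp add: sum_ennreal)
  also have "\<dots> \<le> (\<Sum>j. ennreal (diameter (A j) powr t))"
    using P(1) by (intro sum_le_suminf) auto
  finally show False
    using A(2) by simp
qed

lemma admissible_diams_UN_intervals:
  assumes d: "\<And>k. d k > 0" "d \<longlonglongrightarrow> (0::real)"
  shows "(\<Union>k. {d k..<2 * d k}) \<in> admissible_diams"
proof -
  let ?D = "\<Union>k. {d k..<2 * d k}"
  have dD: "d k \<in> ?D" for k
    using d(1) by (intro UN_I[of k]) auto
  have pos: "?D \<subseteq> {0<..}"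
    using d(1) by (auto intro: less_le_trans)
  have "Inf ?D = 0"
  proof (rule antisym)
    show "Inf ?D \<ge> 0"
      using dD[of 0] pos by (intro cInf_greatest) (blast, force)
    have "bdd_below ?D"
      using pos by (intro bdd_belowI[of _ 0]) (auto simp: less_imp_le)
    then have "Inf ?D \<le> d k" for k
      using dD by (rule cInf_lower[rotated])
    then show "Inf ?D \<le> 0"
      using d(2) by (intro tendsto_lowerbound[OF d(2)]) auto
  qed
  moreover have "\<forall>t\<in>?D. \<exists>\<delta>>0. {t..<t+\<delta>} \<subseteq> ?D"
  proof
    fix t assume "t \<in> ?D"
    then obtain k where "d k \<le> t" "t < 2 * d k"
      by auto
    then show "\<exists>\<delta>>0. {t..<t+\<delta>} \<subseteq> ?D"
      by (intro exI[of _ "2 * d k - t"]) force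
  qed
  moreover have "?D \<noteq> {}"
    using dD[of 0] by (metis empty_iff)
  ultimately show ?thesis
    using pos unfolding admissible_diams_def mem_Collect_eq by (intro conjI)
qed

text \<open>The family \<open>D\<close> must be fixed before the cover is known; this is why the scales \<open>d k\<close> have to work for balls around
  all points of \<open>K\<close> simultaneously.\<close>

lemma restricted_content_ge_1_if_portions_large:
  fixes K :: "'a::metric_space set"
  assumes K: "compact K" "K \<noteq> {}"
    and dim: "\<And>x \<rho>. x \<in> K \<Longrightarrow> \<rho> > 0 \<Longrightarrow> ereal s' < lower_box_dim (K \<inter> ball x \<rho>)"
    and s: "0 \<le> s" "s < s'"
  obtains D where "D \<in> admissible_diams" "\<And>t. 0 \<le> t \<Longrightarrow> t \<le> s \<Longrightarrow> 1 \<le> restricted_content D t K"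
proof -
  have "\<exists>r0>0. \<forall>r x. 0 < r \<longrightarrow> r < r0 \<longrightarrow> x \<in> K \<longrightarrow>
      (\<exists>P. finite P \<and> P \<subseteq> K \<inter> ball x \<rho> \<and> (\<forall>p\<in>P. \<forall>q\<in>P. p \<noteq> q \<longrightarrow> 6 * r \<le> dist p q) \<and>
        r powr (- s) \<le> real (card P))" if \<rho>: "\<rho> > 0" for \<rho>
    by (rule uniformly_many_separated_points[OF K(1) dim s \<rho>])
  then obtain R where R: "\<And>\<rho>. \<rho> > 0 \<Longrightarrow> R \<rho> > 0"
    "\<And>\<rho> r x. \<rho> > 0 \<Longrightarrow> 0 < r \<Longrightarrow> r < R \<rho> \<Longrightarrow> x \<in> K \<Longrightarrow>
      (\<exists>P. finite P \<and> P \<subseteq> K \<inter> ball x \<rho> \<and> (\<forall>p\<in>P. \<forall>q\<in>P. p \<noteq> q \<longrightarrow> 6 * r \<le> dist p q) \<and>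
        r powr (- s) \<le> real (card P))"
    by metis
  define d where "d = rec_nat 1 (\<lambda>_ \<rho>. min (R \<rho>) \<rho> / 2)"
  have d_simps: "d 0 = 1" "d (Suc k) = min (R (d k)) (d k) / 2" for k
    by (simp_all add: d_def)
  have d_pos: "d k > 0" for k
    by (induction k) (use R(1) in \<open>auto simp: d_simps\<close>)
  have d_Suc: "d (Suc k) < R (d k)" "2 * d (Suc k) \<le> d k" for k
    using d_pos[of k] R(1)[of "d k"] by (auto simp: d_simps min_def)
  have d_le: "d k \<le> (1/2) ^ k" for k
  proof (induction k)
    case (Suc k)
    then show ?case using d_Suc(2)[of k] by simp
  qed (simp add: d_simps)
  have d_le_1: "d k \<le> 1" for k
    using d_le[of k] power_le_one[of "1/2::real" k] by linarith
  have d_lim: "d \<longlonglongrightarrow> 0"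
  proof (rule tendsto_sandwich[of "\<lambda>_. 0"])
    show "(\<lambda>k. (1/2) ^ k) \<longlonglongrightarrow> (0::real)"
      by (rule LIMSEQ_realpow_zero) auto
  qed (use d_pos d_le in \<open>auto simp: less_imp_le\<close>)
  define D where "D = (\<Union>k. {d (Suc k)..<2 * d (Suc k)})"
  have "D \<in> admissible_diams"
    unfolding D_def using d_pos LIMSEQ_Suc[OF d_lim] by (rule admissible_diams_UN_intervals)
  moreover have "1 \<le> restricted_content D t K" if t: "0 \<le> t" "t \<le> s" for t
  proof (rule ccontr)
    assume "\<not> 1 \<le> restricted_content D t K"
    then have "restricted_content D t K < 1"
      by simp
    from restricted_content_lessD[OF this]
    obtain A where A: "K \<subseteq> (\<Union>i. A i)" "\<And>i. bounded (A i)" "\<And>i. diameter (A i) \<in> D"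
        "(\<Sum>i. ennreal (diameter (A i) powr t)) < 1"
      by auto
    define avoids where "avoids k p \<longleftrightarrow>
      (\<forall>i. diameter (A i) \<in> {d k..<2 * d k} \<longrightarrow> A i \<inter> cball p (2 * d k) = {})" for k p
    \<comment> \<open>The starting point need not avoid anything, since \<open>d 0\<close> is not among the scales that define \<open>D\<close>.\<close>
    have "\<exists>x. \<forall>n. x n \<in> K \<and> (dist (x n) (x (Suc n)) \<le> d n \<and> avoids (Suc n) (x (Suc n)))"
    proof (rule dependent_nat_choice)
      show "\<exists>x. x \<in> K" using K(2) by blast
      fix x n assume x: "x \<in> K"
      from R(2)[OF d_pos d_pos d_Suc(1) x, of n]
      obtain P where P: "finite P" "P \<subseteq> K \<inter> ball x (d n)"
          "\<forall>p\<in>P. \<forall>q\<in>P. p \<noteq> q \<longrightarrow> 6 * d (Suc n) \<le> dist p q"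
          "d (Suc n) powr (- s) \<le> real (card P)"
        by (elim exE conjE)
      have "\<exists>p\<in>P. avoids (Suc n) p"
        unfolding avoids_def
        using P d_pos d_le_1 t A(2,4) by (intro separated_point_avoiding_one_scale) auto
      then show "\<exists>y. y \<in> K \<and> dist x y \<le> d n \<and> avoids (Suc n) y"
        using P(2) by force
    qed
    then obtain x where x: "\<And>n. x n \<in> K" "\<And>n. dist (x n) (x (Suc n)) \<le> d n"
        "\<And>n. avoids (Suc n) (x (Suc n))"
      by blast
    \<comment> \<open>All later points, and so the limit, stay within the radius \<open>2 * d n\<close> that is cleared around \<open>x n\<close>.\<close>
    have near: "dist (x n) (x (n + m)) \<le> 2 * d n" for n m
    proof (induction m arbitrary: n)
      case 0
      then show ?case using d_pos[of n] by simp
    next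
      case (Suc m)
      have "dist (x n) (x (n + Suc m)) \<le> dist (x n) (x (Suc n)) + dist (x (Suc n)) (x (Suc n + m))"
        using dist_triangle by simp
      also have "\<dots> \<le> d n + 2 * d (Suc n)"
        using x(2) Suc by (intro add_mono)
      finally show ?case
        using d_Suc(2)[of n] by simp
    qed
    obtain l f where l: "l \<in> K" "strict_mono f" "(x \<circ> f) \<longlonglongrightarrow> l"
      using K(1) x(1) unfolding compact_def by metis
    have lim: "dist (x n) l \<le> 2 * d n" for n
    proof (rule tendsto_upperbound)
      show "(\<lambda>m. dist (x n) ((x \<circ> f) m)) \<longlonglongrightarrow> dist (x n) l"
        using l(3) by (intro tendsto_intros)
      show "eventually (\<lambda>m. dist (x n) ((x \<circ> f) m) \<le> 2 * d n) sequentially"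
        using eventually_ge_at_top[of n]
      proof eventually_elim
        case (elim m)
        then have "n \<le> f m"
          using seq_suble[OF l(2), of m] by simp
        then show ?case
          using near[of n "f m - n"] by simp
      qed
    qed simp
    obtain i where i: "l \<in> A i"
      using A(1) l(1) by blast
    obtain k where "diameter (A i) \<in> {d (Suc k)..<2 * d (Suc k)}"
      using A(3)[of i] unfolding D_def by blast
    then have "A i \<inter> cball (x (Suc k)) (2 * d (Suc k)) = {}"
      using x(3) unfolding avoids_def by blast
    then show False
      using i lim[of "Suc k"] by auto
  qed
  ultimately show ?thesis
    using that by blast
qed

section \<open>The lower bound\<close>

lemma restricted_hausdorff_dim_nonneg: "0 \<le> restricted_hausdorff_dim D E"
  unfolding restricted_hausdorff_dim_def by (intro Inf_greatest) auto

lemma universal_hausdorff_dim_nonneg: "0 \<le> universal_hausdorff_dim E"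
proof -
  have "{0<..} \<in> admissible_diams"
    unfolding admissible_diams_def by (auto intro!: exI[of _ 1])
  then show ?thesis
    unfolding universal_hausdorff_dim_def
    using restricted_hausdorff_dim_nonneg by (rule SUP_upper2)
qed

text \<open>The positive content of the kernel \<open>K\<close> at all exponents \<open>0 \<le> t \<le> s\<close> forces the restricted dimension of \<open>E\<close>
  to be at least \<open>s\<close>, for a number \<open>s\<close> chosen above the universal dimension.\<close>

lemma lower_packing_dim_le_universal_hausdorff_dim:
  fixes E :: "'a::euclidean_space set"
  assumes "sigma_compact E"
  shows "lower_packing_dim E \<le> universal_hausdorff_dim E"
proof (rule ccontr)
  assume "\<not> ?thesis"
  then obtain s where s: "universal_hausdorff_dim E < ereal s" "ereal s < lower_packing_dim E"
    using ereal_dense2[of "universal_hausdorff_dim E" "lower_packing_dim E"] by (auto simp: not_le)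
  obtain s' where s': "ereal s < ereal s'" "ereal s' < lower_packing_dim E"
    using ereal_dense2[OF s(2)] by blast
  have s0: "0 \<le> s" "s < s'"
    using le_less_trans[OF universal_hausdorff_dim_nonneg s(1)] s'(1) by auto
  obtain X :: "nat \<Rightarrow> 'a set" where X: "\<And>i. compact (X i)" "E = (\<Union>i. X i)"
    using assms unfolding sigma_compact_def by blast
  have "\<not> sigma_lower_box_dim_le s' (\<Union>(range X))"
    using lower_packing_dim_le_if_sigma_lower_box_dim_le[of s' E] s'(2) X(2) by auto
  then obtain i where i: "\<not> sigma_lower_box_dim_le s' (X i)"
    using sigma_lower_box_dim_le_Union[of "range X" s'] s0 by auto
  obtain K where K: "compact K" "K \<noteq> {}" "K \<subseteq> X i"
    "\<And>x \<rho>. x \<in> K \<Longrightarrow> \<rho> > 0 \<Longrightarrow> ereal s' < lower_box_dim (K \<inter> ball x \<rho>)"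
    using compact_kernel_not_sigma_lower_box_dim_le[OF X(1) i] s0 by auto
  obtain D where D: "D \<in> admissible_diams"
      "\<And>t. 0 \<le> t \<Longrightarrow> t \<le> s \<Longrightarrow> 1 \<le> restricted_content D t K"
    using restricted_content_ge_1_if_portions_large[OF K(1,2,4) s0] by blast
  have KE: "K \<subseteq> E"
    using K(3) X(2) by blast
  have "ereal s \<le> restricted_hausdorff_dim D E"
    unfolding restricted_hausdorff_dim_def
  proof (rule Inf_greatest, clarify)
    fix t assume t: "0 \<le> t" "restricted_content D t E = 0"
    have "restricted_content D t K = 0"
      using restricted_content_mono[OF KE, of D t] t(2) by simp
    then show "ereal s \<le> ereal t"
      using D(2)[OF t(1)] by (cases "t \<le> s") auto
  qed
  also have "\<dots> \<le> universal_hausdorff_dim E"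
    unfolding universal_hausdorff_dim_def using D(1) by (rule SUP_upper)
  finally show False
    using s(1) by simp
qed

theorem theorem4p3:
  fixes E :: "(real ^ 'n) set"
  assumes "sigma_compact E"
  shows "lower_packing_dim E \<le> universal_hausdorff_dim E \<and> universal_hausdorff_dim E \<le> packing_dim E"
  using lower_packing_dim_le_universal_hausdorff_dim[OF assms]
    universal_hausdorff_dim_le_packing_dim by blast

end
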